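(* Let $\omega_0>0$ be fixed and let $B_{\omega_0}=\frac{1-(4\omega_0+1)^{3/2}+6\omega_0}{12}<0$. The period map $$T:(B_{\omega_0},0)\longrightarrow\left(\frac{2\pi}{\sqrt[4]{4\omega_0+1}\sqrt{\sqrt{4\omega_0+1}-1}},+\infty\right)$$ is a smooth function of $B\in(B_{\omega_0},0)$, and $\frac{dT}{dB}>0$.
   Context: $K(k)=\int_0^{\pi/2}(1-k^2\sin^2t)^{-1/2}dt$. Put $I_3=\left(\frac{\sqrt{1+4\omega_0}-1}{2},\frac{\sqrt{48\omega_0+9}-3}{4}\right)$. For $\alpha\in I_3$ let $q(\alpha)=16\omega_0-4\alpha^2-4\alpha+3>0$, $k(\alpha)\in(0,1)$ with $k^2(\alpha)=\frac{\sqrt3\,\alpha\sqrt{q(\alpha)}-12\omega_0+6\alpha^2+9\alpha}{2\sqrt3\,\alpha\sqrt{q(\alpha)}}$, and $$T(\alpha)=\frac{\sqrt8\,3^{1/4}}{\sqrt{\alpha}\,(q(\alpha))^{1/4}}K(k(\alpha)),$$ which is the fundamental period of the positive even periodic solution of $-\phi''+\omega_0\phi-\phi^3-\phi^5=0$, $\phi(0)=\sqrt\alpha$, $\phi'(0)=0$. For $B\in(B_{\omega_0},0)$ let $\alpha(B)\in I_3$ be the solution in $I_3$ of $-\frac{\alpha^3}{3}-\frac{\alpha^2}{2}+\omega_0\alpha+B=0$ (equivalently $B$ is the constant in $(\phi')^2=-\frac{\phi^6}{3}-\frac{\phi^4}{2}+\omega_0\phi^2+B$). The period map as a function of $B$ is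 $T(B):=T(\alpha(B))$. *)

theory Defs
  imports "HOL-Analysis.Analysis"
begin

definition elliptic_K :: "real \<Rightarrow> real" where
  "elliptic_K k = integral {0..pi/2} (\<lambda>t. 1 / sqrt (1 - k\<^sup>2 * (sin t)\<^sup>2))"

definition I3 :: "real \<Rightarrow> real set" where
  "I3 \<omega> = {(sqrt (1 + 4 * \<omega>) - 1) / 2 <..< (sqrt (48 * \<omega> + 9) - 3) / 4}"

definition q_fun :: "real \<Rightarrow> real \<Rightarrow> real" where
  "q_fun \<omega> \<alpha> = 16 * \<omega> - 4 * \<alpha>\<^sup>2 - 4 * \<alpha> + 3"

(* The radicand lies in (0,1) for alpha in I3, see k_mod_in_unit_interval below. *)
definition k_mod :: "real \<Rightarrow> real \<Rightarrow> real" where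
  "k_mod \<omega> \<alpha> =
     sqrt ((sqrt 3 * \<alpha> * sqrt (q_fun \<omega> \<alpha>) - 12 * \<omega> + 6 * \<alpha>\<^sup>2 + 9 * \<alpha>)
           / (2 * sqrt 3 * \<alpha> * sqrt (q_fun \<omega> \<alpha>)))"

(* Fundamental period of the positive even solution of
   - phi'' + omega phi - phi^3 - phi^5 = 0, phi(0) = sqrt alpha, phi'(0) = 0. *)
definition T_alpha :: "real \<Rightarrow> real \<Rightarrow> real" where
  "T_alpha \<omega> \<alpha> = sqrt 8 * root 4 3 / (sqrt \<alpha> * root 4 (q_fun \<omega> \<alpha>)) * elliptic_K (k_mod \<omega> \<alpha>)"

definition B_crit :: "real \<Rightarrow> real" where
  "B_crit \<omega> = (1 - (4 * \<omega> + 1) powr (3/2) + 6 * \<omega>) / 12"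

(* Well defined for B in (B_crit omega, 0), see alpha_of_ex1 below. *)
definition alpha_of :: "real \<Rightarrow> real \<Rightarrow> real" where
  "alpha_of \<omega> B = (THE \<alpha>. \<alpha> \<in> I3 \<omega> \<and> - (\<alpha> ^ 3) / 3 - \<alpha>\<^sup>2 / 2 + \<omega> * \<alpha> + B = 0)"

definition period_map :: "real \<Rightarrow> real \<Rightarrow> real" where
  "period_map \<omega> B = T_alpha \<omega> (alpha_of \<omega> B)"

(* C-infinity; meaningful for open S, where the two-sided derivatives at points of S
   depend only on the values of f on S. *)
definition smooth_on :: "(real \<Rightarrow> real) \<Rightarrow> real set \<Rightarrow> bool" where
  "smooth_on f S \<longleftrightarrow> (\<forall>n. \<forall>x\<in>S. (deriv ^^ n) f differentiable (at x))"

lemma I3_bounds: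
  assumes "\<omega> > 0" and "\<alpha> \<in> I3 \<omega>"
  shows "\<alpha> > 0" and "\<omega> < \<alpha>\<^sup>2 + \<alpha>" and "2 * \<alpha>\<^sup>2 + 3 * \<alpha> < 6 * \<omega>"
proof -
  have s: "sqrt (1 + 4 * \<omega>) < 2 * \<alpha> + 1" and h: "4 * \<alpha> + 3 < sqrt (48 * \<omega> + 9)"
    using assms(2) by (auto simp: I3_def field_simps)
  have "sqrt (1 + 4 * \<omega>) > 1"
    using assms(1) by simp
  with s show pos: "\<alpha> > 0" by linarith
  have "1 + 4 * \<omega> < (2 * \<alpha> + 1)\<^sup>2"
    using real_less_lsqrt s pos by (smt (verit) real_sqrt_less_iff real_sqrt_abs real_sqrt_ge_zero)
  then show "\<omega> < \<alpha>\<^sup>2 + \<alpha>" by (simp add: power2_eq_square algebra_simps)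
  have "(4 * \<alpha> + 3)\<^sup>2 < (sqrt (48 * \<omega> + 9))\<^sup>2"
    using h pos by (intro power_strict_mono) auto
  then have "(4 * \<alpha> + 3)\<^sup>2 < 48 * \<omega> + 9"
    using assms(1) by simp
  then show "2 * \<alpha>\<^sup>2 + 3 * \<alpha> < 6 * \<omega>" by (simp add: power2_eq_square algebra_simps)
qed

lemma q_fun_pos:
  assumes "\<omega> > 0" and "\<alpha> \<in> I3 \<omega>"
  shows "q_fun \<omega> \<alpha> > 0"
  using I3_bounds[OF assms] zero_le_power2[of \<alpha>] unfolding q_fun_def by linarith

lemma k_mod_in_unit_interval:
  assumes "\<omega> > 0" and "\<alpha> \<in> I3 \<omega>"
  shows "k_mod \<omega> \<alpha> \<in> {0<..<1}"
proof -
  define P where "P = 6 * \<alpha>\<^sup>2 + 9 * \<alpha> - 12 * \<omega>"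
  define R where "R = sqrt 3 * \<alpha> * sqrt (q_fun \<omega> \<alpha>)"
  note b = I3_bounds[OF assms] and q = q_fun_pos[OF assms]
  have R: "R > 0" using b q by (simp add: R_def)
  have "R\<^sup>2 = 3 * \<alpha>\<^sup>2 * q_fun \<omega> \<alpha>"
    using q by (simp add: R_def power_mult_distrib)
  then have "R\<^sup>2 - P\<^sup>2 = 24 * ((\<alpha>\<^sup>2 + \<alpha> - \<omega>) * (6 * \<omega> - 2 * \<alpha>\<^sup>2 - 3 * \<alpha>))"
    by (simp add: P_def q_fun_def power2_eq_square algebra_simps)
  moreover have "(\<alpha>\<^sup>2 + \<alpha> - \<omega>) * (6 * \<omega> - 2 * \<alpha>\<^sup>2 - 3 * \<alpha>) > 0"
    using b by (intro mult_pos_pos) auto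
  ultimately have "P\<^sup>2 < R\<^sup>2" by linarith
  then have "\<bar>P\<bar> < R" using R by (metis abs_of_pos power2_less_imp_less power2_abs less_imp_le)
  then have "(R + P) / (2 * R) \<in> {0<..<1}" using R by (auto simp: field_simps)
  moreover have "k_mod \<omega> \<alpha> = sqrt ((R + P) / (2 * R))"
    by (simp add: k_mod_def R_def P_def algebra_simps)
  ultimately show ?thesis by simp
qed

lemma alpha_of_ex1:
  assumes "\<omega> > 0" and "B \<in> {B_crit \<omega><..<0}"
  shows "\<exists>!\<alpha>. \<alpha> \<in> I3 \<omega> \<and> - (\<alpha> ^ 3) / 3 - \<alpha>\<^sup>2 / 2 + \<omega> * \<alpha> + B = 0"
proof -
  define g where "g = (\<lambda>x::real. x ^ 3 / 3 + x\<^sup>2 / 2 - \<omega> * x)"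
  define lo where "lo = (sqrt (1 + 4 * \<omega>) - 1) / 2"
  define hi where "hi = (sqrt (48 * \<omega> + 9) - 3) / 4"
  have I3: "I3 \<omega> = {lo<..<hi}" by (simp add: I3_def lo_def hi_def)
  define s where "s = sqrt (1 + 4 * \<omega>)"
  define h where "h = sqrt (48 * \<omega> + 9)"
  have s2: "s * s = 1 + 4 * \<omega>" and h2: "h * h = 48 * \<omega> + 9"
    using assms(1) by (simp_all add: s_def h_def)
  have s1: "s > 1" using assms(1) by (simp add: s_def)
  have h0: "h > 0" using assms(1) by (simp add: h_def)
  have w: "\<omega> = (s * s - 1) / 4" using s2 by simp
  have powr: "(4 * \<omega> + 1) powr (3/2) = s ^ 3"
  proof -
    have "(4 * \<omega> + 1) powr (3/2) = ((4 * \<omega> + 1) powr (1/2)) powr 3"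
      by (simp add: powr_powr)
    also have "(4 * \<omega> + 1) powr (1/2) = s"
      using assms(1) by (simp add: powr_half_sqrt s_def add.commute)
    also have "s powr 3 = s ^ 3"
      using s1 powr_realpow[of s 3] by simp
    finally show ?thesis .
  qed
  have glo: "g lo = B_crit \<omega>"
    unfolding g_def B_crit_def powr unfolding lo_def s_def[symmetric]
    by (simp add: w field_simps power2_eq_square power3_eq_cube)
  have w': "\<omega> = (h * h - 9) / 48" using h2 by simp
  have ghi: "g hi = 0"
    unfolding g_def hi_def h_def[symmetric]
    by (simp add: w' field_simps power2_eq_square power3_eq_cube)
  have lohi: "lo < hi"
  proof -
    have "(2 * s + 1)\<^sup>2 < h\<^sup>2"
    proof -
      have "0 < (s - 1) * (8 * s + 4)" using s1 by (intro mult_pos_pos) auto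
      then show ?thesis using h2 s2 by (simp add: power2_eq_square algebra_simps)
    qed
    then have "2 * s + 1 < h" using h0 by (simp add: power2_less_imp_less)
    then show ?thesis by (simp add: lo_def hi_def s_def[symmetric] h_def[symmetric])
  qed
  have mono: "g x < g y" if "x \<in> {lo<..<hi}" "y \<in> {lo<..<hi}" "x < y" for x y
  proof (rule DERIV_pos_imp_increasing[OF that(3)])
    fix z assume z: "x \<le> z" "z \<le> y"
    then have "z \<in> I3 \<omega>" using that by (auto simp: I3)
    then have "z\<^sup>2 + z - \<omega> > 0" using I3_bounds[OF assms(1)] by force
    moreover have "(g has_real_derivative (z\<^sup>2 + z - \<omega>)) (at z)"
      unfolding g_def by (auto intro!: derivative_eq_intros)
    ultimately show "\<exists>D. (g has_real_derivative D) (at z) \<and> D > 0" by blast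
  qed
  have "\<exists>x\<ge>lo. x \<le> hi \<and> g x = B"
    by (rule IVT') (use assms(2) glo ghi lohi in \<open>auto simp: g_def intro!: continuous_intros\<close>)
  then obtain x where x: "lo \<le> x" "x \<le> hi" "g x = B" by blast
  have "x \<in> I3 \<omega>" using x assms(2) glo ghi unfolding I3 by (auto simp: less_le)
  moreover have eq: "(- (y ^ 3) / 3 - y\<^sup>2 / 2 + \<omega> * y + B = 0) = (g y = B)" for y
    by (auto simp: g_def)
  ultimately show ?thesis
    unfolding eq I3 using x(3) mono by (metis less_irrefl linorder_neqE_linordered_idom)
qed

end

theory Submission
  imports Defs
begin

text \<open>
  With \<open>m = k\<^sup>2\<close> the period is \<open>\<surd>24 \<rho>\<^sup>-\<^sup>1\<^sup>/\<^sup>4 K\<close>, where \<open>\<rho> = 3 \<alpha>\<^sup>2 q\<close> is a polynomial in \<open>\<alpha>\<close>. The estimate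
  \<open>K \<le> (4 - 3 m) dK/dm\<close>, sharp at \<open>m = 0\<close>, turns \<open>dT/d\<alpha> > 0\<close> into a polynomial inequality.
  At the left endpoint of \<open>I\<^sub>3\<close> the modulus vanishes and the period equals the lower bound, so this
  bound follows from monotonicity. Since \<open>d\<alpha>/dB = 1 / (\<alpha>\<^sup>2 + \<alpha> - \<omega>) > 0\<close>, the sign carries over to \<open>B\<close>.
  For smoothness, the period lies in an algebra of functions of \<open>B\<close> closed under differentiation,
  generated by \<open>\<alpha>\<close>, \<open>d\<alpha>/dB\<close>, \<open>\<rho>\<^sup>-\<^sup>1\<^sup>/\<^sup>4\<close> and the integrals of \<open>sin\<^sup>2\<^sup>n t (1 - m sin\<^sup>2 t)\<^sup>-\<^sup>1\<^sup>/\<^sup>2\<^sup>-\<^sup>n\<close>.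
\<close>

section \<open>Moments of the elliptic integrand\<close>

text \<open>Up to the factor (1/2)(3/2)...(n - 1/2), this is the n-th derivative of the complete
  elliptic integral K with respect to the parameter m = k^2. At m = 0 it is the Wallis integral of
  sin^(2n).\<close>

definition wallis_moment :: "nat \<Rightarrow> real \<Rightarrow> real" where
  "wallis_moment n m =
     integral {0..pi/2} (\<lambda>t. (sin t)\<^sup>2 ^ n * (1 - m * (sin t)\<^sup>2) powr (- (1/2 + real n)))"

lemma elliptic_radicand_pos:
  fixes m t :: real
  assumes "m < 1"
  shows "0 < 1 - m * (sin t)\<^sup>2"
proof (cases "m \<le> 0")
  case True
  then have "m * (sin t)\<^sup>2 \<le> 0" by (simp add: mult_nonpos_nonneg)
  then show ?thesis by linarith
next
  case False
  have "(sin t)\<^sup>2 \<le> 1" using sin_cos_squared_add[of t] zero_le_power2[of "cos t"] by linarith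
  with False have "m * (sin t)\<^sup>2 \<le> m * 1" by (intro mult_left_mono) auto
  then show ?thesis using assms by linarith
qed

lemma wallis_integrable:
  assumes "m < 1"
  shows "(\<lambda>t. (sin t)\<^sup>2 ^ n * (1 - m * (sin t)\<^sup>2) powr r) integrable_on {0..pi/2}"
  by (intro integrable_continuous_interval continuous_intros)
     (use elliptic_radicand_pos[OF assms] in \<open>force simp: less_imp_neq[THEN not_sym]\<close>)

text \<open>Differentiation under the integral sign on the open convex set \<open>{..<1}\<close>,
  where the integrand is smooth in m. This set contains 0 in its interior, which gives a two-sided
  derivative at the left endpoint of \<open>I3\<close>, where m = 0.\<close>

lemma wallis_moment_deriv:
  assumes "m < 1"
  shows "(wallis_moment n has_real_derivative (real n + 1/2) * wallis_moment (Suc n) m) (at m)"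
proof -
  define f where "f x t = (sin t)\<^sup>2 ^ n * (1 - x * (sin t)\<^sup>2) powr (- (1/2 + real n))" for x t :: real
  define f' where "f' x t = (real n + 1/2) * ((sin t)\<^sup>2 ^ Suc n * (1 - x * (sin t)\<^sup>2) powr (- (1/2 + real (Suc n))))"
    for x t :: real
  have "((\<lambda>x. integral (cbox 0 (pi/2)) (f x)) has_field_derivative integral (cbox 0 (pi/2)) (f' m))
          (at m within {..<1})"
  proof (rule leibniz_rule_field_derivative)
    fix x t :: real assume "x \<in> {..<1}"
    then have pos: "0 < 1 - x * (sin t)\<^sup>2" using elliptic_radicand_pos by simp
    define c where "c = - (1/2 + real n)"
    have "((\<lambda>x. (sin t)\<^sup>2 ^ n * (1 - x * (sin t)\<^sup>2) powr c) has_real_derivative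
        (sin t)\<^sup>2 ^ n * (c * (1 - x * (sin t)\<^sup>2) powr (c - 1) * (- (sin t)\<^sup>2))) (at x within {..<1})"
      using pos by (auto intro!: derivative_eq_intros)
    moreover have "(sin t)\<^sup>2 ^ n * (c * (1 - x * (sin t)\<^sup>2) powr (c - 1) * (- (sin t)\<^sup>2)) = f' x t"
      by (simp add: f'_def c_def diff_diff_eq2 algebra_simps)
    ultimately show "((\<lambda>x. f x t) has_field_derivative f' x t) (at x within {..<1})"
      by (simp add: f_def c_def)
  next
    fix x :: real assume "x \<in> {..<1}"
    then show "f x integrable_on cbox 0 (pi/2)"
      unfolding f_def using wallis_integrable[of x n] by simp
  next
    show "continuous_on ({..<1} \<times> cbox 0 (pi/2)) (\<lambda>(x, t). f' x t)"
      unfolding f'_def case_prod_beta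
      by (intro continuous_intros)
         (use elliptic_radicand_pos in \<open>force simp: less_imp_neq[THEN not_sym]\<close>)
  qed (use assms in auto)
  moreover have "integral {0..pi/2} (f' m) = (real n + 1/2) * wallis_moment (Suc n) m"
    unfolding f'_def wallis_moment_def by (rule integral_mult_right)
  moreover have "wallis_moment n = (\<lambda>x. integral (cbox 0 (pi/2)) (f x))"
    unfolding f_def wallis_moment_def by simp
  ultimately show ?thesis
    using assms by (simp add: at_within_open[of m "{..<1}"])
qed

lemma elliptic_K_eq_wallis_moment:
  assumes "k\<^sup>2 < 1"
  shows "elliptic_K k = wallis_moment 0 (k\<^sup>2)"
proof -
  have "1 / sqrt (1 - k\<^sup>2 * (sin t)\<^sup>2) = (1 - k\<^sup>2 * (sin t)\<^sup>2) powr (- (1/2))" for t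
    using elliptic_radicand_pos[OF assms, of t] by (simp add: powr_minus powr_half_sqrt field_simps)
  then show ?thesis
    by (simp add: elliptic_K_def wallis_moment_def)
qed

lemma wallis_moment_0_0: "wallis_moment 0 0 = pi / 2"
  by (simp add: wallis_moment_def)

text \<open>
  The integrand of the difference of the two sides is, up to the derivative of
  \<open>2 sin t cos t (1 - m sin\<^sup>2 t)\<^sup>-\<^sup>1\<^sup>/\<^sup>2\<close>, equal to
  \<open>m s (2 s - 1) w\<close> with \<open>s = sin\<^sup>2 t\<close> and \<open>w = (1 - m s)\<^sup>-\<^sup>3\<^sup>/\<^sup>2\<close>. Since \<open>s w\<close> increases with \<open>s\<close>,
  it may be replaced by its value at \<open>s = 1/2\<close>, and \<open>2 s - 1\<close> has integral zero.
\<close>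
lemma wallis_moment_ineq:
  assumes "0 \<le> m" "m < 1"
  shows "2 * wallis_moment 0 m \<le> (4 - 3 * m) * wallis_moment 1 m"
proof -
  define \<kappa> where "\<kappa> = 1/2 * (1 - m * (1/2)) powr (-3/2)"
  \<comment> \<open>Since sin t cos t has derivative 1 - 2 s, the summand with \<kappa> takes care
    of the replacement of s w by its value at 1/2. \<open>F\<close> vanishes at 0 and pi/2, so
    \<open>F'\<close> has integral 0 and may be added to the integrand freely.\<close>
  define F where "F t = (m * \<kappa> + 2 * (1 - m * (sin t)\<^sup>2) powr (-1/2)) * (sin t * cos t)" for t :: real
  define F' where "F' t = m * \<kappa> * (1 - 2 * (sin t)\<^sup>2)
     + 2 * (1 - 2 * (sin t)\<^sup>2 + m * ((sin t)\<^sup>2)\<^sup>2) * (1 - m * (sin t)\<^sup>2) powr (-3/2)" for t :: real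
  have "(F has_vector_derivative F' t) (at t within {0..pi/2})" for t
  proof -
    define s where "s = (sin t)\<^sup>2"
    have pos: "0 < 1 - m * s" unfolding s_def by (rule elliptic_radicand_pos[OF assms(2)])
    have c2: "(cos t)\<^sup>2 = 1 - s" by (simp add: cos_squared_eq s_def)
    have w: "(1 - m * s) powr (-1/2) = (1 - m * s) * (1 - m * s) powr (-3/2)"
      using powr_add[of "1 - m * s" 1 "-3/2"] pos by simp
    have "(F has_real_derivative
        (2 * ((-1/2) * (1 - m * s) powr (-3/2) * (- (m * (2 * sin t * cos t))))) * (sin t * cos t)
        + (m * \<kappa> + 2 * (1 - m * s) powr (-1/2)) * (cos t * cos t - sin t * sin t)) (at t)"
      unfolding F_def s_def using pos unfolding s_def
      by (auto intro!: derivative_eq_intros simp: algebra_simps)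
    also have "(2 * ((-1/2) * (1 - m * s) powr (-3/2) * (- (m * (2 * sin t * cos t))))) * (sin t * cos t)
        + (m * \<kappa> + 2 * (1 - m * s) powr (-1/2)) * (cos t * cos t - sin t * sin t)
      = 2 * m * (1 - m * s) powr (-3/2) * ((sin t)\<^sup>2 * (cos t)\<^sup>2)
        + (m * \<kappa> + 2 * (1 - m * s) powr (-1/2)) * ((cos t)\<^sup>2 - (sin t)\<^sup>2)"
      by (simp add: power2_eq_square)
    also have "\<dots> = F' t"
      unfolding F'_def c2 w s_def[symmetric] by (simp add: algebra_simps power2_eq_square)
    finally show ?thesis
      by (simp add: has_real_derivative_iff_has_vector_derivative has_vector_derivative_at_within)
  qed
  then have "(F' has_integral (F (pi/2) - F 0)) {0..pi/2}"
    by (intro fundamental_theorem_of_calculus) auto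
  then have F'0: "(F' has_integral 0) {0..pi/2}" by (simp add: F_def)
  define w0 where "w0 t = (sin t)\<^sup>2 ^ 0 * (1 - m * (sin t)\<^sup>2) powr (- (1/2 + real 0))" for t :: real
  define w1 where "w1 t = (sin t)\<^sup>2 ^ 1 * (1 - m * (sin t)\<^sup>2) powr (- (1/2 + real 1))" for t :: real
  have i0: "(w0 has_integral wallis_moment 0 m) {0..pi/2}"
    unfolding w0_def wallis_moment_def by (intro integrable_integral wallis_integrable assms)
  have i1: "(w1 has_integral wallis_moment 1 m) {0..pi/2}"
    unfolding w1_def wallis_moment_def by (intro integrable_integral wallis_integrable assms)
  have "((\<lambda>t. (4 - 3 * m) * w1 t - 2 * w0 t) has_integral
      ((4 - 3 * m) * wallis_moment 1 m - 2 * wallis_moment 0 m)) {0..pi/2}"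
    by (intro has_integral_diff has_integral_mult_right i0 i1)
  moreover have "- F' t \<le> (4 - 3 * m) * w1 t - 2 * w0 t" for t
  proof -
    define s where "s = (sin t)\<^sup>2"
    define w where "w = (1 - m * s) powr (-3/2)"
    have pos: "0 < 1 - m * s" unfolding s_def by (rule elliptic_radicand_pos[OF assms(2)])
    have "s \<ge> 0" by (simp add: s_def)
    have w: "(1 - m * s) powr (-1/2) = (1 - m * s) * w"
      using powr_add[of "1 - m * s" 1 "-3/2"] pos by (simp add: w_def)
    \<comment> \<open>Both factors change sign at s = 1/2 and in the same direction.\<close>
    have "(s * w - \<kappa>) * (2 * s - 1) \<ge> 0"
    proof (cases "s \<ge> 1/2")
      case True
      then have "m * (1/2) \<le> m * s" using assms by (intro mult_left_mono) auto
      then have "(1 - m * (1/2)) powr (-3/2) \<le> w"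
        unfolding w_def using pos by (intro powr_mono2') auto
      then have "\<kappa> \<le> s * w"
        unfolding \<kappa>_def using True by (intro mult_mono) auto
      with True show ?thesis by simp
    next
      case False
      then have "m * s \<le> m * (1/2)" using assms by (intro mult_left_mono) auto
      then have "w \<le> (1 - m * (1/2)) powr (-3/2)"
        unfolding w_def using assms by (intro powr_mono2') auto
      then have "s * w \<le> \<kappa>"
        unfolding \<kappa>_def using False \<open>s \<ge> 0\<close> by (intro mult_mono) (auto simp: w_def)
      with False show ?thesis by (intro mult_nonpos_nonpos) auto
    qed
    then have "0 \<le> m * ((s * w - \<kappa>) * (2 * s - 1))" using assms by simp
    also have "\<dots> = (4 - 3 * m) * (s * w) - 2 * ((1 - m * s) * w) + F' t"
      unfolding F'_def s_def[symmetric] w_def[symmetric] by (simp add: algebra_simps power2_eq_square)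
    also have "\<dots> = (4 - 3 * m) * w1 t - 2 * w0 t + F' t"
      unfolding w0_def w1_def s_def[symmetric] using w by (simp add: w_def)
    finally show ?thesis by simp
  qed
  ultimately have "- 0 \<le> (4 - 3 * m) * wallis_moment 1 m - 2 * wallis_moment 0 m"
    using has_integral_le[OF has_integral_neg[OF F'0]] by blast
  then show ?thesis by simp
qed

lemma wallis_moment_0_pos:
  assumes "0 \<le> m" "m < 1"
  shows "0 < wallis_moment 0 m"
proof -
  have "((\<lambda>t. 1) has_integral pi / 2) {0..pi/2}"
    using has_integral_const_real[of "1::real" 0 "pi/2"] by simp
  moreover have "((\<lambda>t. (sin t)\<^sup>2 ^ 0 * (1 - m * (sin t)\<^sup>2) powr (- (1/2 + real 0)))
      has_integral wallis_moment 0 m) {0..pi/2}"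
    unfolding wallis_moment_def by (intro integrable_integral wallis_integrable assms)
  moreover have "1 \<le> (sin t)\<^sup>2 ^ 0 * (1 - m * (sin t)\<^sup>2) powr (- (1/2 + real 0))" for t
    using powr_mono2'[of "-1/2" "1 - m * (sin t)\<^sup>2" 1] elliptic_radicand_pos[OF assms(2), of t] assms(1)
    by simp
  ultimately have "pi / 2 \<le> wallis_moment 0 m" by (rule has_integral_le)
  then show ?thesis using pi_gt_zero by linarith
qed

text \<open>Since 4 - 3 m > 0, a nonpositive first moment would force the zeroth moment to be
  nonpositive.\<close>

lemma wallis_moment_1_pos:
  assumes "0 \<le> m" "m < 1"
  shows "0 < wallis_moment 1 m"
  using wallis_moment_ineq[OF assms] wallis_moment_0_pos[OF assms] assms
  by (smt (verit) mult_nonneg_nonpos)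


section \<open>Smoothness from function algebras closed under differentiation\<close>

text \<open>There is no constructor for division or composition: reciprocals and composite functions
  enter as generators.\<close>

inductive_set fun_algebra :: "('a \<Rightarrow> real) set \<Rightarrow> ('a \<Rightarrow> real) set" for G where
  const: "(\<lambda>x. c) \<in> fun_algebra G"
| gen: "g \<in> G \<Longrightarrow> g \<in> fun_algebra G"
| add: "f \<in> fun_algebra G \<Longrightarrow> g \<in> fun_algebra G \<Longrightarrow> (\<lambda>x. f x + g x) \<in> fun_algebra G"
| mult: "f \<in> fun_algebra G \<Longrightarrow> g \<in> fun_algebra G \<Longrightarrow> (\<lambda>x. f x * g x) \<in> fun_algebra G"

lemma fun_algebra_diff:
  assumes "f \<in> fun_algebra G" "g \<in> fun_algebra G"
  shows "(\<lambda>x. f x - g x) \<in> fun_algebra G"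
  using fun_algebra.add[OF assms(1) fun_algebra.mult[OF fun_algebra.const[of "-1"] assms(2)]] by simp

lemma fun_algebra_power:
  assumes "f \<in> fun_algebra G"
  shows "(\<lambda>x. f x ^ n) \<in> fun_algebra G"
  by (induction n) (auto intro: fun_algebra.intros assms)

lemmas fun_algebra_intros =
  fun_algebra.const fun_algebra.add fun_algebra.mult fun_algebra_diff fun_algebra_power

text \<open>The sum and product rules extend the hypothesis from the generators to the whole
  algebra.\<close>

lemma fun_algebra_deriv_closed:
  fixes G :: "(real \<Rightarrow> real) set"
  assumes "f \<in> fun_algebra G"
    and "\<And>g. g \<in> G \<Longrightarrow> \<exists>g'\<in>fun_algebra G. \<forall>x\<in>S. (g has_real_derivative g' x) (at x)"
  shows "\<exists>f'\<in>fun_algebra G. \<forall>x\<in>S. (f has_real_derivative f' x) (at x)"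
  using assms(1)
proof induction
  case (const c)
  have "(\<lambda>x. 0) \<in> fun_algebra G" by (rule fun_algebra.const)
  then show ?case by (auto intro!: bexI[of _ "\<lambda>x. 0"])
next
  case (gen g)
  then show ?case by (rule assms(2))
next
  case (add f g)
  then obtain f' g' where "f' \<in> fun_algebra G" "g' \<in> fun_algebra G"
    "\<forall>x\<in>S. (f has_real_derivative f' x) (at x)" "\<forall>x\<in>S. (g has_real_derivative g' x) (at x)" by blast
  then show ?case
    by (intro bexI[of _ "\<lambda>x. f' x + g' x"]) (auto intro!: derivative_intros fun_algebra.add)
next
  case (mult f g)
  then obtain f' g' where "f' \<in> fun_algebra G" "g' \<in> fun_algebra G"
    "\<forall>x\<in>S. (f has_real_derivative f' x) (at x)" "\<forall>x\<in>S. (g has_real_derivative g' x) (at x)" by blast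
  then show ?case
    using mult.hyps
    by (intro bexI[of _ "\<lambda>x. f' x * g x + g' x * f x"])
       (auto intro!: DERIV_mult fun_algebra.add fun_algebra.mult)
qed

lemma smooth_on_fun_algebra:
  fixes G :: "(real \<Rightarrow> real) set"
  assumes "open S"
    and G: "\<And>g. g \<in> G \<Longrightarrow> \<exists>g'\<in>fun_algebra G. \<forall>x\<in>S. (g has_real_derivative g' x) (at x)"
    and "h \<in> fun_algebra G" and "\<And>x. x \<in> S \<Longrightarrow> f x = h x"
  shows "smooth_on f S"
proof -
  \<comment> \<open>Nothing is known about \<open>f\<close> or its iterated derivatives outside
    \<open>S\<close>, so the induction on n only records agreement on \<open>S\<close> with a member
    of the algebra. As \<open>S\<close> is open, this agreement determines the next derivative on
    \<open>S\<close>.\<close>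
  have transfer: "\<exists>g'\<in>fun_algebra G. \<forall>x\<in>S. (u has_real_derivative g' x) (at x)"
    if g: "g \<in> fun_algebra G" and u: "\<forall>x\<in>S. u x = g x" for u g
  proof -
    obtain g' where "g' \<in> fun_algebra G" "\<forall>x\<in>S. (g has_real_derivative g' x) (at x)"
      using fun_algebra_deriv_closed[OF g, of S] G by blast
    with u assms(1) show ?thesis
      by (metis has_field_derivative_transform_within_open)
  qed
  have "\<exists>g\<in>fun_algebra G. \<forall>x\<in>S. (deriv ^^ n) f x = g x" for n
  proof (induction n)
    case 0
    then show ?case using assms(3,4) by auto
  next
    case (Suc n)
    then obtain g where "g \<in> fun_algebra G" "\<forall>x\<in>S. (deriv ^^ n) f x = g x" by blast
    from transfer[OF this] show ?case by (auto dest!: DERIV_imp_deriv)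
  qed
  then show ?thesis
    unfolding smooth_on_def using transfer by (metis real_differentiable_def)
qed

section \<open>Amplitude and squared modulus as functions of \<alpha>\<close>

definition quartic :: "real \<Rightarrow> real \<Rightarrow> real" where
  "quartic \<omega> \<alpha> = 3 * \<alpha>\<^sup>2 * q_fun \<omega> \<alpha>"

text \<open>A single power of a polynomial: its derivative is again a polynomial in \<alpha>,
  \<omega> and the amplitude itself.\<close>

definition amplitude :: "real \<Rightarrow> real \<Rightarrow> real" where
  "amplitude \<omega> \<alpha> = quartic \<omega> \<alpha> powr (-1/4)"

text \<open>The square of \<open>k_mod\<close> on \<open>I3\<close>, with the reciprocal of sqrt 3
  \<alpha> sqrt q expressed through the amplitude so that no further root or quotient has to be
  differentiated.\<close>

definition modulus2 :: "real \<Rightarrow> real \<Rightarrow> real" where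
  "modulus2 \<omega> \<alpha> = 1/2 + (6 * \<alpha>\<^sup>2 + 9 * \<alpha> - 12 * \<omega>) / 2 * (amplitude \<omega> \<alpha>)\<^sup>2"

text \<open>In contrast to \<open>I\<^sub>3\<close>, the left endpoint \<open>\<omega> = \<alpha>\<^sup>2 + \<alpha>\<close> is included.\<close>
definition admissible :: "real \<Rightarrow> real \<Rightarrow> bool" where
  "admissible \<omega> \<alpha> \<longleftrightarrow> 0 < \<alpha> \<and> \<omega> \<le> \<alpha>\<^sup>2 + \<alpha> \<and> 2 * \<alpha>\<^sup>2 + 3 * \<alpha> < 6 * \<omega>"

lemma admissible_I3: "\<omega> > 0 \<Longrightarrow> \<alpha> \<in> I3 \<omega> \<Longrightarrow> admissible \<omega> \<alpha>"
  using I3_bounds[of \<omega> \<alpha>] by (auto simp: admissible_def)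

lemma quartic_pos:
  assumes "admissible \<omega> \<alpha>"
  shows "0 < quartic \<omega> \<alpha>"
proof -
  have "0 < 16 * \<omega> - 4 * \<alpha>\<^sup>2 - 4 * \<alpha> + 3"
    using assms zero_le_power2[of \<alpha>] unfolding admissible_def by linarith
  then show ?thesis using assms by (simp add: quartic_def q_fun_def admissible_def)
qed

text \<open>The two factors are the quantities whose signs are fixed at the endpoints of
  \<open>I3\<close>. With R the root of \<open>quartic\<close> and P the squared term's base, this
  controls m = (R + P) / (2 R).\<close>

lemma quartic_minus_square:
  "quartic \<omega> \<alpha> - (6 * \<alpha>\<^sup>2 + 9 * \<alpha> - 12 * \<omega>)\<^sup>2
    = 24 * ((\<alpha>\<^sup>2 + \<alpha> - \<omega>) * (6 * \<omega> - 2 * \<alpha>\<^sup>2 - 3 * \<alpha>))"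
  by (simp add: quartic_def q_fun_def power2_eq_square algebra_simps)

lemma amplitude_power2:
  assumes "admissible \<omega> \<alpha>"
  shows "(amplitude \<omega> \<alpha>)\<^sup>2 = 1 / sqrt (quartic \<omega> \<alpha>)"
proof -
  have "(amplitude \<omega> \<alpha>)\<^sup>2 = quartic \<omega> \<alpha> powr (- (1/2))"
    using quartic_pos[OF assms] by (simp add: amplitude_def powr_powr flip: powr_realpow)
  then show ?thesis
    using quartic_pos[OF assms] by (simp add: powr_minus powr_half_sqrt field_simps)
qed

lemma modulus2_bounds:
  assumes "admissible \<omega> \<alpha>"
  shows "0 \<le> modulus2 \<omega> \<alpha>" "modulus2 \<omega> \<alpha> < 1"
proof -
  define P where "P = 6 * \<alpha>\<^sup>2 + 9 * \<alpha> - 12 * \<omega>"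
  define R where "R = sqrt (quartic \<omega> \<alpha>)"
  have R: "R > 0" and R2: "R\<^sup>2 = quartic \<omega> \<alpha>"
    using quartic_pos[OF assms] by (auto simp: R_def)
  have diff: "R\<^sup>2 - P\<^sup>2 = 24 * ((\<alpha>\<^sup>2 + \<alpha> - \<omega>) * (6 * \<omega> - 2 * \<alpha>\<^sup>2 - 3 * \<alpha>))"
    unfolding R2 P_def by (rule quartic_minus_square)
  then have "P\<^sup>2 \<le> R\<^sup>2"
    using assms by (smt (verit) admissible_def mult_nonneg_nonneg)
  then have le: "\<bar>P\<bar> \<le> R" using R by (metis abs_le_square_iff abs_of_pos)
  have "P < R"
  \<comment> \<open>At the left endpoint P^2 = R^2, so strictness has to come from P < 0; elsewhere
    the factorization is strictly positive.\<close>
  proof (cases "\<omega> = \<alpha>\<^sup>2 + \<alpha>")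
    case True
    then have "P < 0" using assms by (simp add: P_def admissible_def algebra_simps add_pos_pos)
        (smt (verit) zero_le_power2)
    then show ?thesis using R by simp
  next
    case False
    then have "(\<alpha>\<^sup>2 + \<alpha> - \<omega>) * (6 * \<omega> - 2 * \<alpha>\<^sup>2 - 3 * \<alpha>) > 0"
      using assms by (intro mult_pos_pos) (auto simp: admissible_def)
    then have "P\<^sup>2 < R\<^sup>2" using diff by linarith
    then have "P \<noteq> R" by auto
    then show ?thesis using le by simp
  qed
  have "modulus2 \<omega> \<alpha> = (R + P) / (2 * R)"
    using R by (simp add: modulus2_def amplitude_power2[OF assms] P_def R_def field_simps)
  moreover have "0 \<le> (R + P) / (2 * R)" "(R + P) / (2 * R) < 1"
    using le R(1) \<open>P < R\<close> by (auto simp: divide_simps)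
  ultimately show "0 \<le> modulus2 \<omega> \<alpha>" "modulus2 \<omega> \<alpha> < 1" by simp_all
qed

lemma quartic_deriv:
  "(quartic \<omega> has_real_derivative 6 * \<alpha> * (16 * \<omega> - 8 * \<alpha>\<^sup>2 - 6 * \<alpha> + 3)) (at \<alpha>)"
  unfolding quartic_def q_fun_def
  by (auto intro!: derivative_eq_intros simp: power2_eq_square algebra_simps)

lemma amplitude_deriv:
  assumes "admissible \<omega> \<alpha>"
  shows "(amplitude \<omega> has_real_derivative
    (-1/4) * (6 * \<alpha> * (16 * \<omega> - 8 * \<alpha>\<^sup>2 - 6 * \<alpha> + 3)) * (amplitude \<omega> \<alpha>) ^ 5) (at \<alpha>)"
proof -
  have "(amplitude \<omega> \<alpha>) ^ 5 = quartic \<omega> \<alpha> powr (-1/4 - 1)"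
    using quartic_pos[OF assms] by (simp add: amplitude_def powr_powr flip: powr_realpow)
  then show ?thesis
    using DERIV_fun_powr[OF quartic_deriv quartic_pos[OF assms], of "-1/4"]
    unfolding amplitude_def by (simp add: mult_ac)
qed

lemma modulus2_deriv:
  assumes "admissible \<omega> \<alpha>"
  shows "(modulus2 \<omega> has_real_derivative
    18 * \<alpha> * (2 * \<alpha> ^ 3 + 3 * \<alpha>\<^sup>2 - 6 * \<omega> * \<alpha> + 16 * \<omega>\<^sup>2 + 3 * \<omega>) * (amplitude \<omega> \<alpha>) ^ 6) (at \<alpha>)"
proof -
  define u where "u = amplitude \<omega> \<alpha>"
  define P where "P = 6 * \<alpha>\<^sup>2 + 9 * \<alpha> - 12 * \<omega>"
  define N where "N = 16 * \<omega> - 8 * \<alpha>\<^sup>2 - 6 * \<alpha> + 3"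
  have "(modulus2 \<omega> has_real_derivative
    (12 * \<alpha> + 9) / 2 * u\<^sup>2 + P * u * ((-1/4) * (6 * \<alpha> * N) * u ^ 5)) (at \<alpha>)"
    unfolding modulus2_def u_def P_def N_def
    by (auto intro!: derivative_eq_intros amplitude_deriv[OF assms] simp: power2_eq_square)
  moreover have "u ^ 4 * quartic \<omega> \<alpha> = 1"
  proof -
    have "u ^ 4 = (1 / sqrt (quartic \<omega> \<alpha>))\<^sup>2"
      unfolding amplitude_power2[OF assms, symmetric] u_def by simp
    then show ?thesis
      using quartic_pos[OF assms] by (simp add: power_divide)
  qed
  \<comment> \<open>Multiplying by \<open>u ^ 4 * quartic \<omega> \<alpha>\<close>, which is 1,
    raises the first term to degree 6 in \<open>u\<close>, so \<open>u ^ 6\<close> factors out of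
    the sum.\<close>
  then have "(12 * \<alpha> + 9) / 2 * u\<^sup>2 = (12 * \<alpha> + 9) / 2 * u\<^sup>2 * (u ^ 4 * quartic \<omega> \<alpha>)"
    by simp
  then have "(12 * \<alpha> + 9) / 2 * u\<^sup>2 + P * u * ((-1/4) * (6 * \<alpha> * N) * u ^ 5)
      = u ^ 6 * ((12 * \<alpha> + 9) / 2 * quartic \<omega> \<alpha> - P * (6 * \<alpha> * N) / 4)"
    by (simp add: algebra_simps flip: power_add power_Suc)
  also have "(12 * \<alpha> + 9) / 2 * quartic \<omega> \<alpha> - P * (6 * \<alpha> * N) / 4
      = 18 * \<alpha> * (2 * \<alpha> ^ 3 + 3 * \<alpha>\<^sup>2 - 6 * \<omega> * \<alpha> + 16 * \<omega>\<^sup>2 + 3 * \<omega>)"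
    unfolding P_def N_def quartic_def q_fun_def by (simp add: field_simps) algebra
  ultimately show ?thesis
    by (simp add: u_def mult_ac)
qed

section \<open>The period as a function of \<alpha> and its monotonicity\<close>

lemma period_eq_wallis_moment:
  assumes "\<omega> > 0" "\<alpha> \<in> I3 \<omega>"
  shows "T_alpha \<omega> \<alpha> = sqrt 24 * amplitude \<omega> \<alpha> * wallis_moment 0 (modulus2 \<omega> \<alpha>)"
proof -
  have adm: "admissible \<omega> \<alpha>" using admissible_I3 assms by blast
  have \<alpha>: "\<alpha> > 0" and q: "q_fun \<omega> \<alpha> > 0" using I3_bounds q_fun_pos assms by auto
  define R where "R = sqrt 3 * \<alpha> * sqrt (q_fun \<omega> \<alpha>)"
  have R: "R > 0" "R = sqrt (quartic \<omega> \<alpha>)"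
    using \<alpha> q by (auto simp: R_def quartic_def real_sqrt_mult)
  have "k_mod \<omega> \<alpha> = sqrt (modulus2 \<omega> \<alpha>)"
    unfolding k_mod_def modulus2_def amplitude_power2[OF adm] R(2)[symmetric] mult.assoc[of 2]
    using R(1) by (simp add: R_def[symmetric] mult.assoc[symmetric] add_divide_distrib diff_divide_distrib)
  then have k2: "(k_mod \<omega> \<alpha>)\<^sup>2 = modulus2 \<omega> \<alpha>"
    using modulus2_bounds[OF adm] by simp
  have "amplitude \<omega> \<alpha> = 3 powr (-1/4) * (\<alpha>\<^sup>2) powr (-1/4) * q_fun \<omega> \<alpha> powr (-1/4)"
    using \<alpha> q by (simp add: amplitude_def quartic_def powr_mult)
  also have "3 powr (-1/4) = 1 / root 4 (3::real)"
    by (simp add: root_powr_inverse powr_minus field_simps)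
  also have "q_fun \<omega> \<alpha> powr (-1/4) = 1 / root 4 (q_fun \<omega> \<alpha>)"
    using q by (simp add: root_powr_inverse powr_minus field_simps)
  also have "(\<alpha>\<^sup>2) powr (-1/4) = 1 / sqrt \<alpha>"
  proof -
    have "(\<alpha>\<^sup>2) powr (-1/4) = (\<alpha> powr 2) powr (-1/4)" using \<alpha> by simp
    also have "\<dots> = \<alpha> powr (- (1/2))" unfolding powr_powr by simp
    also have "\<dots> = 1 / sqrt \<alpha>" using \<alpha> by (simp add: powr_minus powr_half_sqrt inverse_eq_divide)
    finally show ?thesis .
  qed
  finally have "amplitude \<omega> \<alpha> = 1 / root 4 3 * (1 / sqrt \<alpha>) * (1 / root 4 (q_fun \<omega> \<alpha>))" .
  \<comment> \<open>The fourth root of 3 is in the numerator of \<open>T_alpha\<close> but in the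
    denominator of \<open>amplitude\<close>, hence it is compensated twice.\<close>
  moreover have "sqrt 24 = sqrt 8 * (root 4 3 * root 4 3)"
  proof -
    have "root 4 3 * root 4 3 = sqrt (3::real)"
      using real_root_mult_exp[of 2 2 "3::real"] by (simp add: sqrt_def flip: power2_eq_square)
    then show ?thesis by (simp flip: real_sqrt_mult)
  qed
  ultimately show ?thesis
    using elliptic_K_eq_wallis_moment[of "k_mod \<omega> \<alpha>"] modulus2_bounds[OF adm]
    by (simp add: T_alpha_def k2)
qed

text \<open>
  With \<open>y = \<alpha>\<^sup>2 + \<alpha> - \<omega>\<close> and \<open>b = 2 \<alpha> + 1\<close> the quartic is \<open>9 \<alpha>\<^sup>2 b\<^sup>2 - 48 \<alpha>\<^sup>2 y\<close>, so its
  square root is at most \<open>3 \<alpha> b - 8 \<alpha> y / b\<close>. Both sides agree at \<open>y = 0\<close>, so a factor \<open>y\<close> splits off.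
\<close>
lemma period_log_deriv_ineq:
  assumes "\<alpha> > 0" "\<omega> < \<alpha>\<^sup>2 + \<alpha>" "2 * \<alpha>\<^sup>2 + 3 * \<alpha> < 6 * \<omega>"
    and "0 \<le> 16 * \<omega> - 8 * \<alpha>\<^sup>2 - 6 * \<alpha> + 3"
  shows "(16 * \<omega> - 8 * \<alpha>\<^sup>2 - 6 * \<alpha> + 3) * (5 * sqrt (quartic \<omega> \<alpha>) - 3 * (6 * \<alpha>\<^sup>2 + 9 * \<alpha> - 12 * \<omega>))
    < 24 * (2 * \<alpha> ^ 3 + 3 * \<alpha>\<^sup>2 - 6 * \<omega> * \<alpha> + 16 * \<omega>\<^sup>2 + 3 * \<omega>)"
proof -
  define y where "y = \<alpha>\<^sup>2 + \<alpha> - \<omega>"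
  define b where "b = 2 * \<alpha> + 1"
  define N where "N = 16 * \<omega> - 8 * \<alpha>\<^sup>2 - 6 * \<alpha> + 3"
  define P where "P = 6 * \<alpha>\<^sup>2 + 9 * \<alpha> - 12 * \<omega>"
  define D where "D = 2 * \<alpha> ^ 3 + 3 * \<alpha>\<^sup>2 - 6 * \<omega> * \<alpha> + 16 * \<omega>\<^sup>2 + 3 * \<omega>"
  define R where "R = sqrt (quartic \<omega> \<alpha>)"
  have \<omega>: "\<omega> = \<alpha>\<^sup>2 + \<alpha> - y" by (simp add: y_def)
  have y: "0 < y" and y': "6 * y < 4 * \<alpha>\<^sup>2 + 3 * \<alpha>" using assms by (auto simp: y_def)
  have b: "b > 0" using assms by (simp add: b_def)
  have R2: "R\<^sup>2 = 9 * \<alpha>\<^sup>2 * b\<^sup>2 - 48 * \<alpha>\<^sup>2 * y"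
    using quartic_pos[of \<omega> \<alpha>] assms
    by (simp add: R_def admissible_def)
       (simp add: quartic_def q_fun_def \<omega> b_def power2_eq_square algebra_simps)
  have "b\<^sup>2 = 4 * \<alpha>\<^sup>2 + 4 * \<alpha> + 1" by (simp add: b_def power2_eq_square algebra_simps)
  then have pos: "3 * b\<^sup>2 - 8 * y \<ge> 0"
    using y' assms(1) zero_le_power2[of \<alpha>] by linarith
  \<comment> \<open>Completing the square in y: the bound on the root misses equality exactly by the
    term 64 (\<alpha> y)^2.\<close>
  have "(b * R)\<^sup>2 + 64 * (\<alpha> * y)\<^sup>2 = (\<alpha> * (3 * b\<^sup>2 - 8 * y))\<^sup>2"
    unfolding power_mult_distrib R2 by (simp add: power2_eq_square algebra_simps)
  then have "(b * R)\<^sup>2 \<le> (\<alpha> * (3 * b\<^sup>2 - 8 * y))\<^sup>2"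
    using zero_le_power2[of "\<alpha> * y"] by linarith
  moreover have "0 \<le> \<alpha> * (3 * b\<^sup>2 - 8 * y)" using pos assms(1) by simp
  ultimately have bR: "b * R \<le> \<alpha> * (3 * b\<^sup>2 - 8 * y)" by (rule power2_le_imp_le)
  \<comment> \<open>The coefficients come from expanding \<open>b * (24 * D + 3 * N * P) - 5 * N *
    (\<alpha> * (3 * b\<^sup>2 - 8 * y))\<close> in powers of y, whose constant term vanishes.
    Inserting the upper bound \<open>y'\<close> leaves a cubic in \<alpha> with positive
    coefficients.\<close>
  have "6 * y * (1024 * \<alpha> + 192) \<le> (4 * \<alpha>\<^sup>2 + 3 * \<alpha>) * (1024 * \<alpha> + 192)"
    using y' assms(1) by (intro mult_right_mono) auto
  also have "\<dots> < 6 * (b * (448 * \<alpha>\<^sup>2 + 240 * \<alpha> + 36))"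
  proof -
    have "6 * (b * (448 * \<alpha>\<^sup>2 + 240 * \<alpha> + 36)) - (4 * \<alpha>\<^sup>2 + 3 * \<alpha>) * (1024 * \<alpha> + 192)
        = 1280 * \<alpha> ^ 3 + 1728 * \<alpha>\<^sup>2 + 1296 * \<alpha> + 216"
      by (simp add: b_def power2_eq_square power3_eq_cube algebra_simps)
    moreover have "\<dots> > 0" using assms(1) by (intro add_pos_pos) auto
    ultimately show ?thesis by linarith
  qed
  finally have "0 < y * (b * (448 * \<alpha>\<^sup>2 + 240 * \<alpha> + 36) - y * (1024 * \<alpha> + 192))"
    using y by simp
  also have "\<dots> = b * (24 * D + 3 * N * P) - 5 * N * (\<alpha> * (3 * b\<^sup>2 - 8 * y))"
    by (simp add: D_def N_def P_def \<omega> b_def power2_eq_square power3_eq_cube algebra_simps)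
  also have "\<dots> \<le> b * (24 * D + 3 * N * P) - 5 * N * (b * R)"
    using mult_left_mono[OF bR, of "5 * N"] assms(4) by (simp add: N_def)
  also have "\<dots> = b * (24 * D - N * (5 * R - 3 * P))"
    by (simp add: algebra_simps)
  finally have "0 < 24 * D - N * (5 * R - 3 * P)"
    using b by (simp add: zero_less_mult_iff)
  then show ?thesis by (simp add: D_def N_def P_def R_def)
qed

definition period_alpha :: "real \<Rightarrow> real \<Rightarrow> real" where
  "period_alpha \<omega> \<alpha> = sqrt 24 * (amplitude \<omega> \<alpha> * wallis_moment 0 (modulus2 \<omega> \<alpha>))"

text \<open>The product rule for amplitude times K, with the positive factor (3/2) \<alpha> u^5
  pulled out, so that the sign sits in the remaining bracket.\<close>

definition period_alpha_deriv :: "real \<Rightarrow> real \<Rightarrow> real" where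
  "period_alpha_deriv \<omega> \<alpha> = sqrt 24 * (3/2 * \<alpha> * (amplitude \<omega> \<alpha>) ^ 5 *
    (6 * (2 * \<alpha> ^ 3 + 3 * \<alpha>\<^sup>2 - 6 * \<omega> * \<alpha> + 16 * \<omega>\<^sup>2 + 3 * \<omega>) * (amplitude \<omega> \<alpha>)\<^sup>2 * wallis_moment 1 (modulus2 \<omega> \<alpha>)
      - (16 * \<omega> - 8 * \<alpha>\<^sup>2 - 6 * \<alpha> + 3) * wallis_moment 0 (modulus2 \<omega> \<alpha>)))"

lemma wallis_modulus2_deriv:
  assumes "admissible \<omega> \<alpha>"
  shows "((\<lambda>\<alpha>. wallis_moment n (modulus2 \<omega> \<alpha>)) has_real_derivative
    (real n + 1/2) * wallis_moment (Suc n) (modulus2 \<omega> \<alpha>) *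
      (18 * \<alpha> * (2 * \<alpha> ^ 3 + 3 * \<alpha>\<^sup>2 - 6 * \<omega> * \<alpha> + 16 * \<omega>\<^sup>2 + 3 * \<omega>) * (amplitude \<omega> \<alpha>) ^ 6)) (at \<alpha>)"
  by (intro DERIV_chain2[OF wallis_moment_deriv modulus2_deriv] modulus2_bounds assms)

lemma period_alpha_has_derivative:
  assumes "admissible \<omega> \<alpha>"
  shows "(period_alpha \<omega> has_real_derivative period_alpha_deriv \<omega> \<alpha>) (at \<alpha>)"
  unfolding period_alpha_def period_alpha_deriv_def
  by (rule DERIV_cmult, rule DERIV_cong[OF DERIV_mult[OF amplitude_deriv wallis_modulus2_deriv]])
     (use assms in \<open>simp_all add: field_simps eval_nat_numeral\<close>)

text \<open>The bracket is positive at once if N <= 0, because D > 0. Otherwise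
  \<open>wallis_moment_ineq\<close> bounds the zeroth moment by the first, and what remains is
  \<open>period_log_deriv_ineq\<close>.\<close>

lemma period_alpha_deriv_pos:
  assumes "\<omega> > 0" "admissible \<omega> \<alpha>" "\<omega> < \<alpha>\<^sup>2 + \<alpha>"
  shows "0 < period_alpha_deriv \<omega> \<alpha>"
proof -
  define m where "m = modulus2 \<omega> \<alpha>"
  define u where "u = amplitude \<omega> \<alpha>"
  define N where "N = 16 * \<omega> - 8 * \<alpha>\<^sup>2 - 6 * \<alpha> + 3"
  define P where "P = 6 * \<alpha>\<^sup>2 + 9 * \<alpha> - 12 * \<omega>"
  define D where "D = 2 * \<alpha> ^ 3 + 3 * \<alpha>\<^sup>2 - 6 * \<omega> * \<alpha> + 16 * \<omega>\<^sup>2 + 3 * \<omega>"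
  define R where "R = sqrt (quartic \<omega> \<alpha>)"
  have m: "0 \<le> m" "m < 1" using modulus2_bounds[OF assms(2)] by (auto simp: m_def)
  have \<alpha>: "\<alpha> > 0" using assms(2) by (simp add: admissible_def)
  have R: "R > 0" using quartic_pos[OF assms(2)] by (simp add: R_def)
  have u2: "u\<^sup>2 = 1 / R" unfolding u_def R_def by (rule amplitude_power2[OF assms(2)])
  have u: "u > 0" using quartic_pos[OF assms(2)] by (simp add: u_def amplitude_def)
  note pos = wallis_moment_0_pos[OF m] wallis_moment_1_pos[OF m]
  have "0 < 6 * D * u\<^sup>2 * wallis_moment 1 m - N * wallis_moment 0 m"
  proof (cases "N \<le> 0")
    case True
    have "D = 2 * \<alpha> ^ 3 + 3 * (\<alpha> - \<omega>)\<^sup>2 + 13 * \<omega>\<^sup>2 + 3 * \<omega>"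
      by (simp add: D_def power2_eq_square algebra_simps)
    also have "\<dots> > 0" using \<alpha> assms(1) by (intro add_pos_pos add_pos_nonneg) auto
    finally have "0 < 6 * D * u\<^sup>2 * wallis_moment 1 m" using u pos by simp
    moreover have "N * wallis_moment 0 m \<le> 0" using True pos by (simp add: mult_nonpos_nonneg)
    ultimately show ?thesis by linarith
  next
    case False
    \<comment> \<open>Inserting m = 1/2 + P / (2 R) turns the factor of the moment inequality into
      the one of the polynomial inequality.\<close>
    have "4 - 3 * m = (5 * R - 3 * P) / (2 * R)"
      using R unfolding m_def modulus2_def P_def[symmetric] u_def[symmetric] u2 by (simp add: field_simps)
    then have "N * (2 * wallis_moment 0 m) \<le> N * ((5 * R - 3 * P) / (2 * R) * wallis_moment 1 m)"
      using wallis_moment_ineq[OF m] False by (intro mult_left_mono) auto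
    also have "\<dots> = N * (5 * R - 3 * P) * (wallis_moment 1 m / (2 * R))"
      by simp
    also have "\<dots> < 24 * D * (wallis_moment 1 m / (2 * R))"
      using period_log_deriv_ineq[OF \<alpha> assms(3)] assms(2) False R pos
      by (intro mult_strict_right_mono) (auto simp: N_def P_def D_def R_def admissible_def)
    also have "\<dots> = 2 * (6 * D * u\<^sup>2 * wallis_moment 1 m)" using R by (simp add: u2)
    finally show ?thesis by linarith
  qed
  then show ?thesis
    unfolding period_alpha_deriv_def m_def[symmetric] u_def[symmetric] N_def[symmetric] D_def[symmetric]
    using \<alpha> u by (intro mult_pos_pos) auto
qed

text \<open>Here \<omega> = \<alpha>^2 + \<alpha>, so \<open>quartic_minus_square\<close> makes the
  quartic a perfect square with root -P. Hence m = 0 and K = pi/2. The value is the period of the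
  linearized oscillation about the constant solution sqrt \<alpha>, whose squared frequency is s (s
  - 1).\<close>

lemma period_alpha_left_endpoint:
  assumes "\<omega> > 0"
  shows "admissible \<omega> ((sqrt (1 + 4 * \<omega>) - 1) / 2)"
    and "period_alpha \<omega> ((sqrt (1 + 4 * \<omega>) - 1) / 2)
      = 2 * pi / (root 4 (4 * \<omega> + 1) * sqrt (sqrt (4 * \<omega> + 1) - 1))"
proof -
  define s where "s = sqrt (1 + 4 * \<omega>)"
  define \<alpha> where "\<alpha> = (s - 1) / 2"
  have s1: "s > 1" and s2: "s\<^sup>2 = 1 + 4 * \<omega>" using assms by (auto simp: s_def)
  have \<alpha>: "\<alpha> > 0" using s1 by (simp add: \<alpha>_def)
  have s: "s = 2 * \<alpha> + 1" by (simp add: \<alpha>_def field_simps)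
  have \<omega>: "\<omega> = \<alpha>\<^sup>2 + \<alpha>" using s2 unfolding s by (simp add: power2_eq_square algebra_simps)
  have adm: "admissible \<omega> \<alpha>"
    using \<alpha> by (simp add: admissible_def \<omega> add_pos_pos)
  then show "admissible \<omega> ((sqrt (1 + 4 * \<omega>) - 1) / 2)" by (simp add: \<alpha>_def s_def)
  have P: "6 * \<alpha>\<^sup>2 + 9 * \<alpha> - 12 * \<omega> = - (3 * \<alpha> * s)"
    by (simp add: \<omega> s power2_eq_square algebra_simps)
  have "quartic \<omega> \<alpha> = (3 * \<alpha> * s)\<^sup>2"
    using quartic_minus_square[of \<omega> \<alpha>] by (simp add: P) (simp add: \<omega>)
  then have u2: "(amplitude \<omega> \<alpha>)\<^sup>2 = 1 / (3 * \<alpha> * s)"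
    using \<alpha> s1 by (simp add: amplitude_power2[OF adm])
  then have m: "modulus2 \<omega> \<alpha> = 0"
    using \<alpha> s1 by (simp add: modulus2_def P)
  have "amplitude \<omega> \<alpha> = sqrt (1 / (3 * \<alpha> * s))"
    using u2 by (metis abs_of_nonneg powr_ge_zero real_sqrt_abs amplitude_def)
  then have "sqrt 24 * amplitude \<omega> \<alpha> = sqrt (24 * (1 / (3 * \<alpha> * s)))"
    by (simp only: real_sqrt_mult)
  also have "24 * (1 / (3 * \<alpha> * s)) = 4\<^sup>2 * (1 / (s * (s - 1)))"
    using s1 by (simp add: \<alpha>_def field_simps)
  also have "sqrt \<dots> = 4 / (sqrt s * sqrt (s - 1))"
    by (simp add: real_sqrt_mult real_sqrt_divide)
  finally have "period_alpha \<omega> \<alpha> = 2 * pi / (sqrt s * sqrt (s - 1))"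
    by (simp add: period_alpha_def m wallis_moment_0_0 mult.assoc[symmetric])
  moreover have "root 4 (4 * \<omega> + 1) = sqrt s"
    using real_root_mult_exp[of 2 2 "4 * \<omega> + 1"] by (simp add: sqrt_def s_def add.commute)
  ultimately show "period_alpha \<omega> ((sqrt (1 + 4 * \<omega>) - 1) / 2)
      = 2 * pi / (root 4 (4 * \<omega> + 1) * sqrt (sqrt (4 * \<omega> + 1) - 1))"
    by (simp add: \<alpha>_def s_def add.commute)
qed

lemma period_alpha_gt:
  assumes "\<omega> > 0" "\<alpha> \<in> I3 \<omega>"
  shows "2 * pi / (root 4 (4 * \<omega> + 1) * sqrt (sqrt (4 * \<omega> + 1) - 1)) < period_alpha \<omega> \<alpha>"
proof -
  define lo where "lo = (sqrt (1 + 4 * \<omega>) - 1) / 2"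
  have lo: "lo < \<alpha>" using assms(2) by (auto simp: I3_def lo_def)
  have I3: "x \<in> I3 \<omega>" if "lo < x" "x \<le> \<alpha>" for x
    using that assms(2) by (auto simp: I3_def lo_def)
  have "period_alpha \<omega> lo < period_alpha \<omega> \<alpha>"
  \<comment> \<open>Positivity of the derivative is used only in the interior; at \<open>lo\<close>
    continuity suffices.\<close>
  proof (rule DERIV_pos_imp_increasing_open[OF lo])
    fix x assume "lo < x" "x < \<alpha>"
    then have "x \<in> I3 \<omega>" using I3 by simp
    then show "\<exists>d. (period_alpha \<omega> has_real_derivative d) (at x) \<and> 0 < d"
      using period_alpha_has_derivative period_alpha_deriv_pos admissible_I3 I3_bounds(2) assms(1) by blast
  next
    have "admissible \<omega> x" if "x \<in> {lo..\<alpha>}" for x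
    proof (cases "x = lo")
      case True
      then show ?thesis using period_alpha_left_endpoint(1)[OF assms(1)] unfolding lo_def by metis
    next
      case False
      then show ?thesis using that I3[of x] admissible_I3 assms(1) by simp
    qed
    then show "continuous_on {lo..\<alpha>} (period_alpha \<omega>)"
      by (meson DERIV_isCont continuous_at_imp_continuous_on period_alpha_has_derivative)
  qed
  then show ?thesis
    using period_alpha_left_endpoint(2)[OF assms(1)] by (simp add: lo_def)
qed

section \<open>Passing from \<alpha> to B\<close>

lemma alpha_of_in_I3:
  assumes "\<omega> > 0" "B \<in> {B_crit \<omega><..<0}"
  shows "alpha_of \<omega> B \<in> I3 \<omega>"
    and "- (alpha_of \<omega> B ^ 3) / 3 - (alpha_of \<omega> B)\<^sup>2 / 2 + \<omega> * alpha_of \<omega> B + B = 0"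
  using theI'[OF alpha_of_ex1[OF assms]] by (simp_all add: alpha_of_def)

text \<open>The inverse function theorem for B = g(\<alpha>), whose derivative \<alpha>^2 + \<alpha>
  - \<omega> is positive on \<open>I3\<close>.\<close>

lemma alpha_of_deriv:
  assumes "\<omega> > 0" "B \<in> {B_crit \<omega><..<0}"
  shows "(alpha_of \<omega> has_real_derivative 1 / ((alpha_of \<omega> B)\<^sup>2 + alpha_of \<omega> B - \<omega>)) (at B)"
proof -
  define g where "g = (\<lambda>x::real. x ^ 3 / 3 + x\<^sup>2 / 2 - \<omega> * x)"
  \<comment> \<open>Uniqueness in \<open>alpha_of_ex1\<close> needs both x in \<open>I3\<close> and
    g x in the range of B; on this set \<open>alpha_of\<close> is a left inverse of
    \<open>g\<close>.\<close>
  define S where "S = I3 \<omega> \<inter> g -` {B_crit \<omega><..<0}"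
  define a where "a = alpha_of \<omega> B"
  have a: "a \<in> I3 \<omega>" "g a = B"
    using alpha_of_in_I3[OF assms] unfolding a_def[symmetric] g_def by linarith+
  have cont: "continuous_on X g" for X unfolding g_def by (intro continuous_intros) auto
  have "open S"
    unfolding S_def by (rule continuous_open_preimage[OF cont]) (auto simp: I3_def)
  moreover have "alpha_of \<omega> (g x) = x" if "x \<in> S" for x
  proof -
    have "g x \<in> {B_crit \<omega><..<0}" "x \<in> I3 \<omega>" using that by (auto simp: S_def)
    moreover have "- (x ^ 3) / 3 - x\<^sup>2 / 2 + \<omega> * x + g x = 0" by (simp add: g_def)
    ultimately show ?thesis
      using alpha_of_ex1[OF assms(1)] alpha_of_in_I3[OF assms(1)] by blast
  qed
  moreover have "(g has_derivative (*) (a\<^sup>2 + a - \<omega>)) (at a)"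
    unfolding has_field_derivative_def[symmetric] g_def by (auto intro!: derivative_eq_intros)
  moreover have "a\<^sup>2 + a - \<omega> > 0" using I3_bounds(2)[OF assms(1) a(1)] by simp
  then have "(*) (a\<^sup>2 + a - \<omega>) \<circ> (*) (1 / (a\<^sup>2 + a - \<omega>)) = id"
    by (auto simp: fun_eq_iff)
  moreover have "a \<in> S" using a assms(2) by (simp add: S_def)
  ultimately have "(alpha_of \<omega> has_derivative (*) (1 / (a\<^sup>2 + a - \<omega>))) (at B)"
    using has_derivative_inverse_strong_x[of S "alpha_of \<omega>" B g] cont[of S] a(2)
    unfolding a_def[symmetric] by blast
  then show ?thesis by (simp add: has_field_derivative_def a_def)
qed

lemma period_map_eq:
  assumes "\<omega> > 0" "B \<in> {B_crit \<omega><..<0}"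
  shows "period_map \<omega> B = period_alpha \<omega> (alpha_of \<omega> B)"
  using period_eq_wallis_moment[OF assms(1) alpha_of_in_I3(1)[OF assms]]
  by (simp add: period_map_def period_alpha_def)

lemma period_map_smooth:
  assumes "\<omega> > 0"
  shows "smooth_on (period_map \<omega>) {B_crit \<omega><..<0}"
proof -
  define a where "a = alpha_of \<omega>"
  define d where "d B = 1 / ((a B)\<^sup>2 + a B - \<omega>)" for B
  define u where "u B = amplitude \<omega> (a B)" for B
  define J where "J n B = wallis_moment n (modulus2 \<omega> (a B))" for n B
  \<comment> \<open>Differentiation raises the index of \<open>J\<close>, so all moments are
    included. The reciprocal \<open>d\<close> closes up because its derivative is -(2 a + 1)
    d^3.\<close>
  define G where "G = {a, d, u} \<union> range J"
  have gens: "a \<in> fun_algebra G" "d \<in> fun_algebra G" "u \<in> fun_algebra G" "J n \<in> fun_algebra G" for n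
    by (auto simp: G_def intro: fun_algebra.gen)
  let ?S = "{B_crit \<omega><..<0}"
  have a': "(a has_real_derivative d B) (at B)" if "B \<in> ?S" for B
    using alpha_of_deriv[OF assms that] by (simp add: a_def d_def)
  have adm: "admissible \<omega> (a B)" and nz: "(a B)\<^sup>2 + a B - \<omega> \<noteq> 0" if "B \<in> ?S" for B
    using alpha_of_in_I3[OF assms that] admissible_I3 I3_bounds(2) assms by (force simp: a_def)+
  have d': "(d has_real_derivative (- (2 * a B + 1) * d B ^ 3)) (at B)" if "B \<in> ?S" for B
  proof -
    define e where "e B = (a B)\<^sup>2 + a B - \<omega>" for B
    have "(e has_real_derivative (2 * a B + 1) * d B) (at B)"
      unfolding e_def[abs_def] by (auto intro!: derivative_eq_intros a'[OF that] simp: algebra_simps)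
    moreover have "e B \<noteq> 0" using nz[OF that] by (simp add: e_def)
    moreover have d: "d = (\<lambda>B. inverse (e B))" by (simp add: d_def[abs_def] e_def inverse_eq_divide)
    ultimately show ?thesis
      using DERIV_inverse_fun[of e "(2 * a B + 1) * d B" B] by (simp add: power3_eq_cube algebra_simps)
  qed
  have u': "(u has_real_derivative
      (-1/4) * (6 * a B * (16 * \<omega> - 8 * (a B)\<^sup>2 - 6 * a B + 3)) * u B ^ 5 * d B) (at B)" if "B \<in> ?S" for B
    using DERIV_chain2[OF amplitude_deriv[OF adm[OF that]] a'[OF that]] by (simp add: u_def[abs_def])
  have J': "(J n has_real_derivative (real n + 1/2) * J (Suc n) B *
      (18 * a B * (2 * a B ^ 3 + 3 * (a B)\<^sup>2 - 6 * \<omega> * a B + 16 * \<omega>\<^sup>2 + 3 * \<omega>) * u B ^ 6) * d B) (at B)"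
    if "B \<in> ?S" for n B
    using DERIV_chain2[OF wallis_modulus2_deriv[OF adm[OF that]] a'[OF that]]
    by (simp add: u_def J_def[abs_def])
  show ?thesis
  proof (rule smooth_on_fun_algebra)
    show "(\<lambda>B. sqrt 24 * (u B * J 0 B)) \<in> fun_algebra G"
      by (intro fun_algebra_intros gens)
    show "period_map \<omega> B = sqrt 24 * (u B * J 0 B)" if "B \<in> ?S" for B
      using period_map_eq[OF assms that] by (simp add: period_alpha_def u_def J_def a_def)
  next
    fix g assume "g \<in> G"
    then consider "g = a" | "g = d" | "g = u" | n where "g = J n" by (auto simp: G_def)
    then show "\<exists>g'\<in>fun_algebra G. \<forall>x\<in>?S. (g has_real_derivative g' x) (at x)"
    proof cases
      case 1
      then show ?thesis using a' gens by blast
    next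
      case 2
      \<comment> \<open>Unary minus is written as a product with the constant -1 to fit the closure
        rules.\<close>
      have "(\<lambda>B. (-1 * (2 * a B + 1)) * d B ^ 3) \<in> fun_algebra G"
        by (intro fun_algebra_intros gens)
      with 2 show ?thesis using d' by (intro bexI) auto
    next
      case 3
      have "(\<lambda>B. (-1/4) * (6 * a B * (16 * \<omega> - 8 * (a B)\<^sup>2 - 6 * a B + 3)) * u B ^ 5 * d B) \<in> fun_algebra G"
        by (intro fun_algebra_intros gens)
      with 3 show ?thesis using u' by (intro bexI) auto
    next
      case 4
      have "(\<lambda>B. (real n + 1/2) * J (Suc n) B *
        (18 * a B * (2 * a B ^ 3 + 3 * (a B)\<^sup>2 - 6 * \<omega> * a B + 16 * \<omega>\<^sup>2 + 3 * \<omega>) * u B ^ 6) * d B) \<in> fun_algebra G"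
        by (intro fun_algebra_intros gens)
      with 4 show ?thesis using J' by (intro bexI) auto
    qed
  qed auto
qed

lemma period_map_deriv_pos:
  assumes "\<omega> > 0" "B \<in> {B_crit \<omega><..<0}"
  shows "0 < deriv (period_map \<omega>) B"
proof -
  define a where "a = alpha_of \<omega> B"
  have a: "a \<in> I3 \<omega>" using alpha_of_in_I3[OF assms] by (simp add: a_def)
  have "((\<lambda>B. period_alpha \<omega> (alpha_of \<omega> B)) has_real_derivative
      period_alpha_deriv \<omega> a * (1 / (a\<^sup>2 + a - \<omega>))) (at B)"
    using DERIV_chain2[OF period_alpha_has_derivative alpha_of_deriv] assms a admissible_I3
    by (simp add: a_def)
  then have "(period_map \<omega> has_real_derivative period_alpha_deriv \<omega> a * (1 / (a\<^sup>2 + a - \<omega>))) (at B)"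
    by (rule has_field_derivative_transform_within_open[of _ _ B "{B_crit \<omega><..<0}"])
       (simp_all only: open_greaterThanLessThan assms(2) period_map_eq[OF assms(1)])
  moreover have "0 < period_alpha_deriv \<omega> a * (1 / (a\<^sup>2 + a - \<omega>))"
    using period_alpha_deriv_pos admissible_I3 I3_bounds(2) assms(1) a by simp
  ultimately show ?thesis using DERIV_imp_deriv by fastforce
qed

text \<open>In s = sqrt (4 \<omega> + 1), \<open>B_crit\<close> is a cubic with a double root at s =
  1, and it is negative for s > 1.\<close>

lemma B_crit_neg:
  assumes "\<omega> > 0"
  shows "B_crit \<omega> < 0"
proof -
  define s where "s = sqrt (4 * \<omega> + 1)"
  have s1: "s > 1" and s2: "s\<^sup>2 = 4 * \<omega> + 1" using assms by (auto simp: s_def)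
  have "(4 * \<omega> + 1) powr (3/2) = s powr 3"
    using assms powr_powr[of "4 * \<omega> + 1" "1/2" 3] by (simp add: s_def powr_half_sqrt)
  then have "(4 * \<omega> + 1) powr (3/2) = s ^ 3"
    using s1 by simp
  moreover have "\<omega> = (s\<^sup>2 - 1) / 4" using s2 by simp
  ultimately have "B_crit \<omega> = - ((s - 1)\<^sup>2 * (2 * s + 1)) / 24"
    by (simp add: B_crit_def power2_eq_square power3_eq_cube field_simps)
  moreover have "0 < (s - 1)\<^sup>2 * (2 * s + 1)" using s1 by (intro mult_pos_pos) auto
  ultimately show ?thesis by simp
qed

theorem proposition3p1:
  fixes \<omega>\<^sub>0 :: real
  assumes "\<omega>\<^sub>0 > 0"
  shows "B_crit \<omega>\<^sub>0 < 0 \<and>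
    period_map \<omega>\<^sub>0 \<in> {B_crit \<omega>\<^sub>0<..<0} \<rightarrow>
      {2 * pi / (root 4 (4 * \<omega>\<^sub>0 + 1) * sqrt (sqrt (4 * \<omega>\<^sub>0 + 1) - 1))<..} \<and>
    smooth_on (period_map \<omega>\<^sub>0) {B_crit \<omega>\<^sub>0<..<0} \<and>
    (\<forall>B\<in>{B_crit \<omega>\<^sub>0<..<0}. deriv (period_map \<omega>\<^sub>0) B > 0)"
  using B_crit_neg[OF assms] period_map_smooth[OF assms] period_map_deriv_pos[OF assms]
    period_alpha_gt[OF assms alpha_of_in_I3(1)[OF assms]] period_map_eq[OF assms]
  by (simp add: Pi_iff del: greaterThanLessThan_iff)

end
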